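(* Let $\beta,\gamma,\delta>0$ with $\beta+\gamma>\delta$, let $\alpha=\beta+\gamma-\delta>0$, and let $x,y,z\in(0,1)$. Let $U_{00},U_{01},U_{10},U_{11}$ be the means and $P,Q,R,S,T,V$ the propositions defined in the context, and assume that all of $U_{00},U_{01},U_{10},U_{11}$ lie in $(0,1)$. Then $$\max\{\sin^{\alpha}(\pi U_{00}),\sin^{\alpha}(\pi U_{01}),\sin^{\alpha}(\pi U_{10}),\sin^{\alpha}(\pi U_{11})\}=\begin{cases}\sin^{\alpha}(\pi U_{00}),&\text{if }P,\ Q,\ R\text{ hold},\\ \sin^{\alpha}(\pi U_{01}),&\text{if }\neg P,\ S,\ V\text{ hold},\\ \sin^{\alpha}(\pi U_{10}),&\text{if }\neg Q,\ T,\ \neg V\text{ hold},\\ \sin^{\alpha}(\pi U_{11}),&\text{if }\neg R,\ \neg S,\ \neg T\text{ hold}.\end{cases}$$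
   Context: The means are $$U_{00}=\frac{\beta x+\gamma y-\delta z}{\alpha},\quad U_{01}=\frac{\beta x+\gamma(1-y)-\delta z}{\alpha},\quad U_{10}=\frac{\beta(1-x)+\gamma y-\delta z}{\alpha},\quad U_{11}=\frac{\beta(1-x)+\gamma(1-y)-\delta z}{\alpha}.$$ The propositions are \begin{align*} P&:\ (2y-1)\bigl(\beta(2x-1)+\delta(1-2z)\bigr)\le0,\\ Q&:\ (2x-1)\bigl(\gamma(2y-1)+\delta(1-2z)\bigr)\le0,\\ R&:\ \bigl(\beta(2x-1)+\gamma(2y-1)\bigr)(1-2z)\le0,\\ S&:\ (2x-1)\bigl(\gamma(1-2y)+\delta(1-2z)\bigr)\le0,\\ T&:\ (2y-1)\bigl(\beta(1-2x)+\delta(1-2z)\bigr)\le0,\\ V&:\ (1-2z)\bigl(\beta(2x-1)+\gamma(1-2y)\bigr)\le0, \end{align*} and $\neg$ denotes negation. Here $\sin^{c}(t)$ denotes $(\sin t)^c$. *)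

theory Defs
  imports Complex_Main
begin

definition U00 :: "real \<Rightarrow> real \<Rightarrow> real \<Rightarrow> real \<Rightarrow> real \<Rightarrow> real \<Rightarrow> real \<Rightarrow> real" where
  "U00 \<alpha> \<beta> \<gamma> \<delta> x y z = (\<beta> * x + \<gamma> * y - \<delta> * z) / \<alpha>"

definition U01 :: "real \<Rightarrow> real \<Rightarrow> real \<Rightarrow> real \<Rightarrow> real \<Rightarrow> real \<Rightarrow> real \<Rightarrow> real" where
  "U01 \<alpha> \<beta> \<gamma> \<delta> x y z = (\<beta> * x + \<gamma> * (1 - y) - \<delta> * z) / \<alpha>"

definition U10 :: "real \<Rightarrow> real \<Rightarrow> real \<Rightarrow> real \<Rightarrow> real \<Rightarrow> real \<Rightarrow> real \<Rightarrow> real" where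
  "U10 \<alpha> \<beta> \<gamma> \<delta> x y z = (\<beta> * (1 - x) + \<gamma> * y - \<delta> * z) / \<alpha>"

definition U11 :: "real \<Rightarrow> real \<Rightarrow> real \<Rightarrow> real \<Rightarrow> real \<Rightarrow> real \<Rightarrow> real \<Rightarrow> real" where
  "U11 \<alpha> \<beta> \<gamma> \<delta> x y z = (\<beta> * (1 - x) + \<gamma> * (1 - y) - \<delta> * z) / \<alpha>"

text \<open>
  The six propositions take the same parameter list \<open>\<beta> \<gamma> \<delta> x y z\<close>, although each mentions
  only two of the three weights. Each compares two of the four means: up to a positive factor,
  the left-hand side is \<open>(U - U') * (U + U' - 1)\<close> for the pairs
  \<open>00/01\<close>, \<open>00/10\<close>, \<open>00/11\<close>, \<open>01/11\<close>, \<open>10/11\<close>, \<open>01/10\<close> respectively.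
\<close>

definition propP :: "real \<Rightarrow> real \<Rightarrow> real \<Rightarrow> real \<Rightarrow> real \<Rightarrow> real \<Rightarrow> bool" where
  "propP \<beta> \<gamma> \<delta> x y z \<longleftrightarrow> (2 * y - 1) * (\<beta> * (2 * x - 1) + \<delta> * (1 - 2 * z)) \<le> 0"

definition propQ :: "real \<Rightarrow> real \<Rightarrow> real \<Rightarrow> real \<Rightarrow> real \<Rightarrow> real \<Rightarrow> bool" where
  "propQ \<beta> \<gamma> \<delta> x y z \<longleftrightarrow> (2 * x - 1) * (\<gamma> * (2 * y - 1) + \<delta> * (1 - 2 * z)) \<le> 0"

definition propR :: "real \<Rightarrow> real \<Rightarrow> real \<Rightarrow> real \<Rightarrow> real \<Rightarrow> real \<Rightarrow> bool" where
  "propR \<beta> \<gamma> \<delta> x y z \<longleftrightarrow> (\<beta> * (2 * x - 1) + \<gamma> * (2 * y - 1)) * (1 - 2 * z) \<le> 0"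

definition propS :: "real \<Rightarrow> real \<Rightarrow> real \<Rightarrow> real \<Rightarrow> real \<Rightarrow> real \<Rightarrow> bool" where
  "propS \<beta> \<gamma> \<delta> x y z \<longleftrightarrow> (2 * x - 1) * (\<gamma> * (1 - 2 * y) + \<delta> * (1 - 2 * z)) \<le> 0"

definition propT :: "real \<Rightarrow> real \<Rightarrow> real \<Rightarrow> real \<Rightarrow> real \<Rightarrow> real \<Rightarrow> bool" where
  "propT \<beta> \<gamma> \<delta> x y z \<longleftrightarrow> (2 * y - 1) * (\<beta> * (1 - 2 * x) + \<delta> * (1 - 2 * z)) \<le> 0"

definition propV :: "real \<Rightarrow> real \<Rightarrow> real \<Rightarrow> real \<Rightarrow> real \<Rightarrow> real \<Rightarrow> bool" where
  "propV \<beta> \<gamma> \<delta> x y z \<longleftrightarrow> (1 - 2 * z) * (\<beta> * (2 * x - 1) + \<gamma> * (1 - 2 * y)) \<le> 0"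

text \<open>
  \<open>sin_pow c t\<close> is \<open>(sin t)\<^sup>c\<close> with a real exponent. Since \<open>powr\<close> is only
  meaningful for a positive base, it is meant for \<open>0 < t < pi\<close>.
\<close>

definition sin_pow :: "real \<Rightarrow> real \<Rightarrow> real" where
  "sin_pow c t = sin t powr c"

end

(* On (0,1) the function t \<mapsto> sin (pi t) powr \<alpha> is a decreasing function of the distance from t
   to 1/2, so the maximum is attained at the mean closest to 1/2. Since
   (u - 1/2)^2 - (v - 1/2)^2 = (u - v) (u + v - 1), each of the six propositions compares two of
   these distances, and the four cases select the first minimiser in the order 00, 01, 10, 11. *)
theory Submission
  imports Defs
begin

text \<open>Centring at 1/2 turns the sine into a cosine of \<open>pi * \<bar>t - 1/2\<bar>\<close>,
  and cosine decreases on [0, pi]. Raising to a nonnegative power preserves the resulting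
  inequality. Squares measure the distance here because their differences factor
  polynomially.\<close>

lemma sin_pow_pi_antimono:
  assumes "\<alpha> \<ge> 0" and "v \<in> {0<..<1}" and "(u - 1/2)\<^sup>2 \<le> (v - 1/2)\<^sup>2"
  shows "sin_pow \<alpha> (pi * v) \<le> sin_pow \<alpha> (pi * u)"
proof -
  have sin_eq: "sin (pi * t) = cos (pi * \<bar>t - 1/2\<bar>)" for t
  proof -
    have "sin (pi * t) = cos (pi * (t - 1/2))"
      by (simp add: right_diff_distrib cos_diff)
    also have "\<dots> = cos \<bar>pi * (t - 1/2)\<bar>"
      by (rule cos_abs_real [symmetric])
    finally show ?thesis by (simp add: abs_mult)
  qed
  have "\<bar>u - 1/2\<bar> \<le> \<bar>v - 1/2\<bar>"
    using assms(3) by (simp add: abs_le_square_iff)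
  \<comment> \<open>A bound of 1 on this larger distance already keeps both cosine arguments inside
    [0, pi].\<close>
  moreover have "\<bar>v - 1/2\<bar> \<le> 1"
    using assms(2) by (auto simp: abs_if)
  ultimately have "sin (pi * v) \<le> sin (pi * u)"
    unfolding sin_eq by (intro cos_monotone_0_pi_le) (simp_all add: mult_left_le)
  \<comment> \<open>Monotonicity of \<open>powr\<close> in its base requires the smaller base to be
    nonnegative.\<close>
  moreover have "0 \<le> sin (pi * v)"
    using assms(2) by (intro sin_ge_zero) (auto simp: mult_left_le)
  ultimately show ?thesis
    unfolding sin_pow_def using assms(1) by (intro powr_mono2)
qed

text \<open>The difference of the two squares is \<open>(u - v) * (u + v - 1)\<close>, and positive
  factors do not change its sign. In the applications \<open>c\<close> is \<alpha>, which clears the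
  denominators of the means, and \<open>k\<close> is the weight that the proposition with left-hand
  side \<open>N\<close> leaves out.\<close>

lemma square_dist_half_le_iff:
  fixes u v k c :: real
  assumes "c > 0" and "k > 0" and "k * N = (c * (u - v)) * (c * (u + v - 1))"
  shows "N \<le> 0 \<longleftrightarrow> (u - 1/2)\<^sup>2 \<le> (v - 1/2)\<^sup>2"
proof -
  have "(u - 1/2)\<^sup>2 - (v - 1/2)\<^sup>2 = (u - v) * (u + v - 1)"
    by (simp add: power2_eq_square algebra_simps)
  moreover have "N \<le> 0 \<longleftrightarrow> k * N \<le> 0"
    using assms(2) by (simp add: mult_le_0_iff)
  moreover have "k * N \<le> 0 \<longleftrightarrow> (u - v) * (u + v - 1) \<le> 0"
    unfolding assms(3) using assms(1) by (simp add: mult_le_0_iff zero_le_mult_iff)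
  ultimately show ?thesis by linarith
qed

theorem theorem4p3:
  fixes \<alpha> \<beta> \<gamma> \<delta> x y z :: real
  assumes "\<beta> > 0" and "\<gamma> > 0" and "\<delta> > 0"
    and "\<beta> + \<gamma> > \<delta>"
    and "\<alpha> = \<beta> + \<gamma> - \<delta>"
    and "x \<in> {0<..<1}" and "y \<in> {0<..<1}" and "z \<in> {0<..<1}"
    and "U00 \<alpha> \<beta> \<gamma> \<delta> x y z \<in> {0<..<1}"
    and "U01 \<alpha> \<beta> \<gamma> \<delta> x y z \<in> {0<..<1}"
    and "U10 \<alpha> \<beta> \<gamma> \<delta> x y z \<in> {0<..<1}"
    and "U11 \<alpha> \<beta> \<gamma> \<delta> x y z \<in> {0<..<1}"
  defines "M \<equiv> Max {sin_pow \<alpha> (pi * U00 \<alpha> \<beta> \<gamma> \<delta> x y z),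
                    sin_pow \<alpha> (pi * U01 \<alpha> \<beta> \<gamma> \<delta> x y z),
                    sin_pow \<alpha> (pi * U10 \<alpha> \<beta> \<gamma> \<delta> x y z),
                    sin_pow \<alpha> (pi * U11 \<alpha> \<beta> \<gamma> \<delta> x y z)}"
    and "C00 \<equiv> propP \<beta> \<gamma> \<delta> x y z \<and> propQ \<beta> \<gamma> \<delta> x y z \<and> propR \<beta> \<gamma> \<delta> x y z"
    and "C01 \<equiv> \<not> propP \<beta> \<gamma> \<delta> x y z \<and> propS \<beta> \<gamma> \<delta> x y z \<and> propV \<beta> \<gamma> \<delta> x y z"
    and "C10 \<equiv> \<not> propQ \<beta> \<gamma> \<delta> x y z \<and> propT \<beta> \<gamma> \<delta> x y z \<and> \<not> propV \<beta> \<gamma> \<delta> x y z"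
    and "C11 \<equiv> \<not> propR \<beta> \<gamma> \<delta> x y z \<and> \<not> propS \<beta> \<gamma> \<delta> x y z \<and> \<not> propT \<beta> \<gamma> \<delta> x y z"
  shows "(C00 \<longrightarrow> M = sin_pow \<alpha> (pi * U00 \<alpha> \<beta> \<gamma> \<delta> x y z)) \<and>
         (C01 \<longrightarrow> M = sin_pow \<alpha> (pi * U01 \<alpha> \<beta> \<gamma> \<delta> x y z)) \<and>
         (C10 \<longrightarrow> M = sin_pow \<alpha> (pi * U10 \<alpha> \<beta> \<gamma> \<delta> x y z)) \<and>
         (C11 \<longrightarrow> M = sin_pow \<alpha> (pi * U11 \<alpha> \<beta> \<gamma> \<delta> x y z)) \<and>
         (C00 \<or> C01 \<or> C10 \<or> C11)"
proof -
  define d where "d u = (u - 1/2)\<^sup>2" for u :: real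
  let ?u00 = "U00 \<alpha> \<beta> \<gamma> \<delta> x y z"
  let ?u01 = "U01 \<alpha> \<beta> \<gamma> \<delta> x y z"
  let ?u10 = "U10 \<alpha> \<beta> \<gamma> \<delta> x y z"
  let ?u11 = "U11 \<alpha> \<beta> \<gamma> \<delta> x y z"
  have \<alpha>: "\<alpha> > 0"
    using assms(4,5) by simp
  \<comment> \<open>Stating the means multiplied by \<alpha> lets the six comparisons below proceed
    by polynomial algebra, without division.\<close>
  have means:
    "\<alpha> * ?u00 = \<beta> * x + \<gamma> * y - \<delta> * z"
    "\<alpha> * ?u01 = \<beta> * x + \<gamma> * (1 - y) - \<delta> * z"
    "\<alpha> * ?u10 = \<beta> * (1 - x) + \<gamma> * y - \<delta> * z"
    "\<alpha> * ?u11 = \<beta> * (1 - x) + \<gamma> * (1 - y) - \<delta> * z"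
    using \<alpha> by (simp_all add: U00_def U01_def U10_def U11_def)
  \<comment> \<open>The means 00 and 01 differ only in the \<gamma> term, so their difference
    supplies the factor \<gamma> that \<open>propP\<close> omits. In the sum the y terms add up to
    \<gamma>, which cancels against the \<gamma> in \<alpha>.\<close>
  have P: "propP \<beta> \<gamma> \<delta> x y z \<longleftrightarrow> d ?u00 \<le> d ?u01"
  proof -
    have "\<alpha> * (?u00 - ?u01) = \<gamma> * (2 * y - 1)"
      and "\<alpha> * (?u00 + ?u01 - 1) = \<beta> * (2 * x - 1) + \<delta> * (1 - 2 * z)"
      unfolding right_diff_distrib distrib_left means by (simp_all add: assms(5) algebra_simps)
    then have "\<gamma> * ((2 * y - 1) * (\<beta> * (2 * x - 1) + \<delta> * (1 - 2 * z)))
        = (\<alpha> * (?u00 - ?u01)) * (\<alpha> * (?u00 + ?u01 - 1))"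
      by (simp only: ac_simps)
    then show ?thesis
      unfolding propP_def d_def using \<alpha> assms(1-3)
      by (intro square_dist_half_le_iff)
  qed
  have Q: "propQ \<beta> \<gamma> \<delta> x y z \<longleftrightarrow> d ?u00 \<le> d ?u10"
  proof -
    have "\<alpha> * (?u00 - ?u10) = \<beta> * (2 * x - 1)"
      and "\<alpha> * (?u00 + ?u10 - 1) = \<gamma> * (2 * y - 1) + \<delta> * (1 - 2 * z)"
      unfolding right_diff_distrib distrib_left means by (simp_all add: assms(5) algebra_simps)
    then have "\<beta> * ((2 * x - 1) * (\<gamma> * (2 * y - 1) + \<delta> * (1 - 2 * z)))
        = (\<alpha> * (?u00 - ?u10)) * (\<alpha> * (?u00 + ?u10 - 1))"
      by (simp only: ac_simps)
    then show ?thesis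
      unfolding propQ_def d_def using \<alpha> assms(1-3)
      by (intro square_dist_half_le_iff)
  qed
  \<comment> \<open>Both x and y are reflected between 00 and 11, so their terms cancel from the sum
    minus 1. The omitted weight is therefore \<delta>, coming from the sum instead of the
    difference; the same happens for \<open>propV\<close>.\<close>
  have R: "propR \<beta> \<gamma> \<delta> x y z \<longleftrightarrow> d ?u00 \<le> d ?u11"
  proof -
    have "\<alpha> * (?u00 - ?u11) = \<beta> * (2 * x - 1) + \<gamma> * (2 * y - 1)"
      and "\<alpha> * (?u00 + ?u11 - 1) = \<delta> * (1 - 2 * z)"
      unfolding right_diff_distrib distrib_left means by (simp_all add: assms(5) algebra_simps)
    then have "\<delta> * ((\<beta> * (2 * x - 1) + \<gamma> * (2 * y - 1)) * (1 - 2 * z))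
        = (\<alpha> * (?u00 - ?u11)) * (\<alpha> * (?u00 + ?u11 - 1))"
      by (simp only: ac_simps)
    then show ?thesis
      unfolding propR_def d_def using \<alpha> assms(1-3)
      by (intro square_dist_half_le_iff)
  qed
  have S: "propS \<beta> \<gamma> \<delta> x y z \<longleftrightarrow> d ?u01 \<le> d ?u11"
  proof -
    have "\<alpha> * (?u01 - ?u11) = \<beta> * (2 * x - 1)"
      and "\<alpha> * (?u01 + ?u11 - 1) = \<gamma> * (1 - 2 * y) + \<delta> * (1 - 2 * z)"
      unfolding right_diff_distrib distrib_left means by (simp_all add: assms(5) algebra_simps)
    then have "\<beta> * ((2 * x - 1) * (\<gamma> * (1 - 2 * y) + \<delta> * (1 - 2 * z)))
        = (\<alpha> * (?u01 - ?u11)) * (\<alpha> * (?u01 + ?u11 - 1))"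
      by (simp only: ac_simps)
    then show ?thesis
      unfolding propS_def d_def using \<alpha> assms(1-3)
      by (intro square_dist_half_le_iff)
  qed
  have T: "propT \<beta> \<gamma> \<delta> x y z \<longleftrightarrow> d ?u10 \<le> d ?u11"
  proof -
    have "\<alpha> * (?u10 - ?u11) = \<gamma> * (2 * y - 1)"
      and "\<alpha> * (?u10 + ?u11 - 1) = \<beta> * (1 - 2 * x) + \<delta> * (1 - 2 * z)"
      unfolding right_diff_distrib distrib_left means by (simp_all add: assms(5) algebra_simps)
    then have "\<gamma> * ((2 * y - 1) * (\<beta> * (1 - 2 * x) + \<delta> * (1 - 2 * z)))
        = (\<alpha> * (?u10 - ?u11)) * (\<alpha> * (?u10 + ?u11 - 1))"
      by (simp only: ac_simps)
    then show ?thesis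
      unfolding propT_def d_def using \<alpha> assms(1-3)
      by (intro square_dist_half_le_iff)
  qed
  have V: "propV \<beta> \<gamma> \<delta> x y z \<longleftrightarrow> d ?u01 \<le> d ?u10"
  proof -
    have "\<alpha> * (?u01 - ?u10) = \<beta> * (2 * x - 1) + \<gamma> * (1 - 2 * y)"
      and "\<alpha> * (?u01 + ?u10 - 1) = \<delta> * (1 - 2 * z)"
      unfolding right_diff_distrib distrib_left means by (simp_all add: assms(5) algebra_simps)
    then have "\<delta> * ((1 - 2 * z) * (\<beta> * (2 * x - 1) + \<gamma> * (1 - 2 * y)))
        = (\<alpha> * (?u01 - ?u10)) * (\<alpha> * (?u01 + ?u10 - 1))"
      by (simp only: ac_simps)
    then show ?thesis
      unfolding propV_def d_def using \<alpha> assms(1-3)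
      by (intro square_dist_half_le_iff)
  qed
  have mono: "sin_pow \<alpha> (pi * v) \<le> sin_pow \<alpha> (pi * u)" if "d u \<le> d v" "v \<in> {0<..<1}" for u v
    using sin_pow_pi_antimono [of \<alpha> v u] that \<alpha> by (simp add: d_def)
  let ?F = "{sin_pow \<alpha> (pi * ?u00), sin_pow \<alpha> (pi * ?u01),
              sin_pow \<alpha> (pi * ?u10), sin_pow \<alpha> (pi * ?u11)}"
  \<comment> \<open>Any minimiser of \<open>d\<close> among the four means will do, so ties are
    harmless.\<close>
  have M: "M = sin_pow \<alpha> (pi * u)"
    if "u \<in> {?u00, ?u01, ?u10, ?u11}" "d u \<le> d ?u00"
      "d u \<le> d ?u01" "d u \<le> d ?u10" "d u \<le> d ?u11" for u
    unfolding M_def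
  proof (rule Max_eqI)
    show "finite ?F"
      by simp
    show "s \<le> sin_pow \<alpha> (pi * u)"
      if "s \<in> ?F" for s
      \<comment> \<open>Interval membership is kept folded so that the assumptions on the means
        match the second premise of \<open>mono\<close>.\<close>
      using that assms(9-12)
      by (auto intro: mono \<open>d u \<le> d ?u00\<close> \<open>d u \<le> d ?u01\<close> \<open>d u \<le> d ?u10\<close> \<open>d u \<le> d ?u11\<close>
          simp del: greaterThanLessThan_iff)
    show "sin_pow \<alpha> (pi * u) \<in> ?F"
      using \<open>u \<in> {?u00, ?u01, ?u10, ?u11}\<close> by auto
  qed
  show ?thesis
  proof (intro conjI impI)
    \<comment> \<open>Each case compares one mean with the three others. A negated proposition gives
      a strict inequality in the opposite direction, which is weakened to the one \<open>M\<close>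
      needs.\<close>
    show "M = sin_pow \<alpha> (pi * ?u00)" if C00
      using that unfolding C00_def P Q R by (intro M) auto
    show "M = sin_pow \<alpha> (pi * ?u01)" if C01
      using that unfolding C01_def P S V by (intro M) auto
    show "M = sin_pow \<alpha> (pi * ?u10)" if C10
      using that unfolding C10_def Q T V by (intro M) auto
    show "M = sin_pow \<alpha> (pi * ?u11)" if C11
      using that unfolding C11_def R S T by (intro M) auto
    \<comment> \<open>The splits order the distances of 00, 01 and 10. Two of the eight combinations
      are cyclic and hence contradictory; in the others the first minimiser of the three is known,
      and either it is no farther from 1/2 than 11, or 11 is strictly closest.\<close>
    show "C00 \<or> C01 \<or> C10 \<or> C11"
      unfolding C00_def C01_def C10_def C11_def P Q R S T V
      by (cases "d ?u00 \<le> d ?u01"; cases "d ?u00 \<le> d ?u10"; cases "d ?u01 \<le> d ?u10"; linarith)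
  qed
qed

end
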